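(* For every integer $n\geq 2$, the Baumslag-Solitar group $BS(1,n)$ admits a strongly aperiodic subshift of finite type.
   Context: $BS(1,n)=\langle a,b \mid b a b^{-1} = a^n\rangle$. Let $G$ be a finitely generated group with identity $e$ and $\mathcal{A}$ a finite alphabet. $G$ acts on $\mathcal{A}^G$ by $(g\cdot x)_h = x_{g^{-1}h}$. A pattern is an element $p\in\mathcal{A}^{P}$ with $P\subset G$ finite; it appears in $x\in\mathcal{A}^G$ if there is $g\in G$ with $(g\cdot x)_h=p_h$ for all $h\in P$. A subshift of finite type (SFT) on $G$ is the set of all $x\in\mathcal{A}^G$ in which no pattern of some fixed finite set of patterns appears. A configuration $x$ is weakly periodic if its stabilizer $\{g\in G\mid g\cdot x=x\}$ is not $\{e\}$. An SFT is strongly aperiodic if it is non-empty and contains no weakly periodic configuration. *)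

theory Defs
  imports "HOL-Algebra.Group_Action"
begin

section \<open>Groups given by generators and relations\<close>

text \<open>A word is a list of letters; the letter \<open>(g, True)\<close> stands for the generator \<open>g\<close>
  and \<open>(g, False)\<close> for its inverse.\<close>

type_synonym 'g word = "('g \<times> bool) list"

inductive pres_eq :: "('g word \<times> 'g word) set \<Rightarrow> 'g word \<Rightarrow> 'g word \<Rightarrow> bool"
  for R :: "('g word \<times> 'g word) set" where
  pres_refl: "pres_eq R u u"
| pres_sym: "pres_eq R u v \<Longrightarrow> pres_eq R v u"
| pres_trans: "pres_eq R u v \<Longrightarrow> pres_eq R v w \<Longrightarrow> pres_eq R u w"
| pres_cancel: "pres_eq R (u @ [(g, s), (g, \<not> s)] @ v) (u @ v)"
| pres_rel: "(l, r) \<in> R \<Longrightarrow> pres_eq R (u @ l @ v) (u @ r @ v)"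

definition pres_class :: "('g word \<times> 'g word) set \<Rightarrow> 'g word \<Rightarrow> 'g word set" where
  "pres_class R u = {v. pres_eq R u v}"

text \<open>The group generated by all elements of type \<open>'g\<close>, subject to the relations
  \<open>l = r\<close> for \<open>(l, r) \<in> R\<close>.\<close>

definition presented_group :: "('g word \<times> 'g word) set \<Rightarrow> 'g word set monoid" where
  "presented_group R =
    \<lparr> carrier = range (pres_class R),
      mult = (\<lambda>X Y. \<Union>u\<in>X. \<Union>v\<in>Y. pres_class R (u @ v)),
      one = pres_class R [] \<rparr>"

lemma pres_eq_append_left: "pres_eq R u v \<Longrightarrow> pres_eq R (w @ u) (w @ v)"
proof (induction rule: pres_eq.induct)
  case (pres_cancel u g s v)
  then show ?case using pres_eq.pres_cancel[of R "w @ u" g s v] by simp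
next
  case (pres_rel l r u v)
  then show ?case using pres_eq.pres_rel[of l r R "w @ u" v] by simp
next
  case (pres_trans u v w)
  then show ?case by (metis pres_eq.pres_trans)
qed (rule pres_eq.pres_refl, rule pres_eq.pres_sym)

lemma pres_eq_append_right: "pres_eq R u v \<Longrightarrow> pres_eq R (u @ w) (v @ w)"
proof (induction rule: pres_eq.induct)
  case (pres_cancel u g s v)
  then show ?case using pres_eq.pres_cancel[of R u g s "v @ w"] by simp
next
  case (pres_rel l r u v)
  then show ?case using pres_eq.pres_rel[of l r R u "v @ w"] by simp
next
  case (pres_trans u v w)
  then show ?case by (metis pres_eq.pres_trans)
qed (rule pres_eq.pres_refl, rule pres_eq.pres_sym)

lemma pres_eq_append:
  "pres_eq R u u' \<Longrightarrow> pres_eq R v v' \<Longrightarrow> pres_eq R (u @ v) (u' @ v')"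
  by (rule pres_trans[OF pres_eq_append_right pres_eq_append_left])

lemma pres_class_eq_iff: "pres_class R u = pres_class R v \<longleftrightarrow> pres_eq R u v"
proof
  assume "pres_class R u = pres_class R v"
  then have "v \<in> pres_class R u" by (simp add: pres_class_def pres_refl)
  then show "pres_eq R u v" by (simp add: pres_class_def)
next
  assume "pres_eq R u v"
  then have "pres_eq R u w \<longleftrightarrow> pres_eq R v w" for w by (metis pres_sym pres_trans)
  then show "pres_class R u = pres_class R v" by (simp add: pres_class_def)
qed

lemma pres_class_mult:
  "pres_class R u \<otimes>\<^bsub>presented_group R\<^esub> pres_class R v = pres_class R (u @ v)"
proof -
  have *: "pres_class R (u' @ v') = pres_class R (u @ v)"
    if "u' \<in> pres_class R u" "v' \<in> pres_class R v" for u' v'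
  proof -
    have "pres_eq R (u @ v) (u' @ v')"
      by (rule pres_eq_append) (use that in \<open>simp_all add: pres_class_def\<close>)
    then show ?thesis unfolding pres_class_eq_iff by (rule pres_sym)
  qed
  have "u \<in> pres_class R u" "v \<in> pres_class R v"
    by (simp_all add: pres_class_def pres_refl)
  then have "(\<Union>u'\<in>pres_class R u. \<Union>v'\<in>pres_class R v. pres_class R (u' @ v'))
      = pres_class R (u @ v)"
    using * by blast
  then show ?thesis by (simp add: presented_group_def)
qed

lemma pres_eq_inverse: "pres_eq R (rev (map (\<lambda>(g, s). (g, \<not> s)) u) @ u) []"
proof (induction u)
  case Nil
  then show ?case by (simp add: pres_refl)
next
  case (Cons x u)
  obtain g s where x: "x = (g, s)" by force
  have "pres_eq R (rev (map (\<lambda>(g, s). (g, \<not> s)) u) @ [(g, \<not> s), (g, \<not> \<not> s)] @ u)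
     (rev (map (\<lambda>(g, s). (g, \<not> s)) u) @ u)"
    by (rule pres_cancel)
  from pres_trans[OF this Cons.IH] show ?case using x by simp
qed

lemma group_presented_group: "group (presented_group R)"
proof (rule groupI)
  fix x assume "x \<in> carrier (presented_group R)"
  then obtain u where u: "x = pres_class R u" by (auto simp: presented_group_def)
  show "\<exists>y\<in>carrier (presented_group R). y \<otimes>\<^bsub>presented_group R\<^esub> x = \<one>\<^bsub>presented_group R\<^esub>"
  proof
    show "pres_class R (rev (map (\<lambda>(g, s). (g, \<not> s)) u)) \<otimes>\<^bsub>presented_group R\<^esub> x
        = \<one>\<^bsub>presented_group R\<^esub>"
      unfolding u pres_class_mult
      by (simp add: presented_group_def pres_class_eq_iff pres_eq_inverse)
  qed (simp add: presented_group_def)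
next
  fix x assume "x \<in> carrier (presented_group R)"
  then obtain u where u: "x = pres_class R u" by (auto simp: presented_group_def)
  have one: "\<one>\<^bsub>presented_group R\<^esub> = pres_class R []" by (simp add: presented_group_def)
  show "\<one>\<^bsub>presented_group R\<^esub> \<otimes>\<^bsub>presented_group R\<^esub> x = x"
    unfolding u one pres_class_mult by simp
next
  fix x y assume "x \<in> carrier (presented_group R)" "y \<in> carrier (presented_group R)"
  then obtain u v where uv: "x = pres_class R u" "y = pres_class R v"
    by (auto simp: presented_group_def)
  show "x \<otimes>\<^bsub>presented_group R\<^esub> y \<in> carrier (presented_group R)"
    unfolding uv pres_class_mult by (simp add: presented_group_def)
next
  fix x y z
  assume "x \<in> carrier (presented_group R)" "y \<in> carrier (presented_group R)"
    "z \<in> carrier (presented_group R)"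
  then obtain u v w where uvw: "x = pres_class R u" "y = pres_class R v" "z = pres_class R w"
    by (auto simp: presented_group_def)
  show "x \<otimes>\<^bsub>presented_group R\<^esub> y \<otimes>\<^bsub>presented_group R\<^esub> z
      = x \<otimes>\<^bsub>presented_group R\<^esub> (y \<otimes>\<^bsub>presented_group R\<^esub> z)"
    unfolding uvw pres_class_mult by simp
qed (simp add: presented_group_def)

section \<open>The Baumslag--Solitar groups \<open>BS(1,n)\<close>\<close>

datatype bs_gen = gen_a | gen_b

definition BS1 :: "nat \<Rightarrow> bs_gen word set monoid" where
  "BS1 n = presented_group
    {([(gen_b, True), (gen_a, True), (gen_b, False)], replicate n (gen_a, True))}"

lemma group_BS1: "group (BS1 n)"
  unfolding BS1_def by (rule group_presented_group)

section \<open>Subshifts of finite type\<close>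

definition configurations :: "('g, 'm) monoid_scheme \<Rightarrow> 'c set \<Rightarrow> ('g \<Rightarrow> 'c) set" where
  "configurations G A = carrier G \<rightarrow>\<^sub>E A"

definition shift ::
    "('g, 'm) monoid_scheme \<Rightarrow> 'c set \<Rightarrow> 'g \<Rightarrow> ('g \<Rightarrow> 'c) \<Rightarrow> ('g \<Rightarrow> 'c)" where
  "shift G A g = (\<lambda>x \<in> configurations G A. \<lambda>h \<in> carrier G. x (inv\<^bsub>G\<^esub> g \<otimes>\<^bsub>G\<^esub> h))"

text \<open>A pattern \<open>(P, p)\<close> is a function \<open>p\<close> on a finite support \<open>P\<close>; the support is carried
  along because it cannot be recovered from \<open>p\<close>.\<close>

definition patterns :: "('g, 'm) monoid_scheme \<Rightarrow> 'c set \<Rightarrow> ('g set \<times> ('g \<Rightarrow> 'c)) set" where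
  "patterns G A = {(P, p). finite P \<and> P \<subseteq> carrier G \<and> p \<in> P \<rightarrow>\<^sub>E A}"

definition appears ::
    "('g, 'm) monoid_scheme \<Rightarrow> 'c set \<Rightarrow> 'g set \<times> ('g \<Rightarrow> 'c) \<Rightarrow> ('g \<Rightarrow> 'c) \<Rightarrow> bool" where
  "appears G A = (\<lambda>(P, p) x. \<exists>g\<in>carrier G. \<forall>h\<in>P. shift G A g x h = p h)"

definition is_SFT :: "('g, 'm) monoid_scheme \<Rightarrow> 'c set \<Rightarrow> ('g \<Rightarrow> 'c) set \<Rightarrow> bool" where
  "is_SFT G A X \<longleftrightarrow> (\<exists>F. finite F \<and> F \<subseteq> patterns G A \<and>
     X = {x \<in> configurations G A. \<forall>p\<in>F. \<not> appears G A p x})"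

definition weakly_periodic ::
    "('g, 'm) monoid_scheme \<Rightarrow> 'c set \<Rightarrow> ('g \<Rightarrow> 'c) \<Rightarrow> bool" where
  "weakly_periodic G A x \<longleftrightarrow> stabilizer G (shift G A) x \<noteq> {\<one>\<^bsub>G\<^esub>}"

definition strongly_aperiodic ::
    "('g, 'm) monoid_scheme \<Rightarrow> 'c set \<Rightarrow> ('g \<Rightarrow> 'c) set \<Rightarrow> bool" where
  "strongly_aperiodic G A X \<longleftrightarrow> X \<noteq> {} \<and> (\<forall>x\<in>X. \<not> weakly_periodic G A x)"

lemma group_action_shift:
  assumes "group G"
  shows "group_action G (configurations G A) (shift G A)"
proof -
  interpret group G by fact
  let ?C = "configurations G A"
  have closed: "shift G A g x \<in> ?C" if "g \<in> carrier G" "x \<in> ?C" for g x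
    using that by (auto simp: shift_def configurations_def)
  have comp: "shift G A g (shift G A k x) = shift G A (g \<otimes>\<^bsub>G\<^esub> k) x"
    if "g \<in> carrier G" "k \<in> carrier G" "x \<in> ?C" for g k x
    using closed[OF that(2,3)] that(1,2)
    by (simp add: shift_def that(3) inv_mult_group m_assoc cong: restrict_cong)
  have one: "shift G A \<one>\<^bsub>G\<^esub> x = x" if "x \<in> ?C" for x
    using that by (auto simp: shift_def configurations_def PiE_def extensional_def fun_eq_iff)
  have bij: "bij_betw (shift G A g) ?C ?C" if "g \<in> carrier G" for g
    using that
    by (intro bij_betw_byWitness[where f' = "shift G A (inv\<^bsub>G\<^esub> g)"]) (auto simp: comp one closed)
  have Bij: "shift G A g \<in> Bij ?C" if "g \<in> carrier G" for g
    using bij[OF that] by (auto simp: Bij_def shift_def)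
  have "shift G A (g \<otimes>\<^bsub>G\<^esub> k) = compose ?C (shift G A g) (shift G A k)"
    if "g \<in> carrier G" "k \<in> carrier G" for g k
  proof
    fix x
    show "shift G A (g \<otimes>\<^bsub>G\<^esub> k) x = compose ?C (shift G A g) (shift G A k) x"
      using comp[OF that] by (cases "x \<in> ?C") (simp add: compose_def, simp add: compose_def shift_def)
  qed
  then have "shift G A \<in> hom G (BijGroup ?C)"
    using Bij by (auto simp: hom_def BijGroup_def)
  then show ?thesis
    by (simp add: group_action_def group_hom_def group_hom_axioms_def group_BijGroup assms)
qed

end

theory Submission
  imports Defs Complex_Main "HOL-Library.Nat_Bijection"
begin

text \<open>Following Kari, each coset \<open>g\<langle>a\<rangle>\<close> carries a sequence of digits between \<open>1\<close> and \<open>n(n+1)\<close>,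
  thought of as representing the real number that is its average. Since \<open>a b\<inverse> = b\<inverse> a\<^sup>n\<close>, every
  coset has a unique parent, reached by \<open>b\<inverse>\<close>, in which each of its elements corresponds to a block
  of \<open>n\<close> elements. A local rule with bounded carries forces the number represented on the parent
  to be \<open>n\<close> times or \<open>1/(n+1)\<close> times that on the coset, the choice being constant on the coset.

  Up to conjugation a period of a configuration either is \<open>a\<^sup>k\<close> or moves levels. A period moving
  \<open>M > 0\<close> levels would multiply averages by some \<open>n\<^sup>i / (n+1)\<^sup>j \<noteq> 1\<close> up to an error that vanishes
  for long blocks; iterating contradicts the bounds on the digits. If \<open>a\<^sup>k\<close> is a period, then the
  \<open>l\<close>-th ancestor of \<open>\<langle>a\<rangle>\<close> has period \<open>k n\<^sup>l\<close>, so all averages are exact rationals whose denominators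
  contain only a bounded power of \<open>n + 1\<close>; this bounds \<open>j\<close>, the digit bound then bounds \<open>i\<close>, but
  \<open>i + j = l\<close>. Conversely, Beatty sequences \<open>\<lfloor>x(z+1)\<rfloor> - \<lfloor>xz\<rfloor>\<close> of an infinite orbit in \<open>[1, n(n+1)]\<close>
  of the two scalings give a configuration.\<close>

section \<open>Digit sequences linked by carries\<close>

text \<open>Level \<open>l + 1\<close> models the parent of level \<open>l\<close>: its positions
  \<open>n * u\<close> to \<open>n * u + n - 1\<close> form the block of \<open>u\<close>. Averages
  change by the factor \<open>r l / s l\<close>, and \<open>e\<close> passes the rounding from left
  to right.\<close>

locale digit_lines =
  fixes n K E :: nat and s r :: "nat \<Rightarrow> nat" and d e :: "nat \<Rightarrow> int \<Rightarrow> nat"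
  assumes n_ge_2: "n \<ge> 2"
    and d_pos: "1 \<le> d l u" and d_le: "d l u \<le> K" and e_le: "e l u \<le> E"
    and ratio: "(s l, r l) = (1, n) \<or> (s l, r l) = (n + 1, 1)"
    and rule: "s l * (\<Sum>i<n. d (Suc l) (int n * u + int i)) + e l u
      = r l * n * d l u + e l (u + 1)"
begin

section \<open>Block sums and their passage to the parent\<close>

definition dsum :: "nat \<Rightarrow> int \<Rightarrow> nat \<Rightarrow> nat" where
  "dsum l v N = (\<Sum>u<N. d l (v + int u))"

lemma dsum_0 [simp]: "dsum l v 0 = 0"
  by (simp add: dsum_def)

lemma dsum_Suc: "dsum l v (Suc N) = dsum l v N + d l (v + int N)"
  by (simp add: dsum_def)

lemma dsum_add: "dsum l v (M + N) = dsum l v M + dsum l (v + int M) N"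
  by (induction N) (simp_all add: dsum_Suc add.assoc)

lemma dsum_ge: "N \<le> dsum l v N"
  using sum_mono[of "{..<N}" "\<lambda>_. 1" "\<lambda>u. d l (v + int u)"] d_pos by (simp add: dsum_def)

lemma dsum_le: "dsum l v N \<le> N * K"
  using sum_mono[of "{..<N}" "\<lambda>u. d l (v + int u)" "\<lambda>_. K"] d_le by (simp add: dsum_def)

text \<open>Over consecutive blocks the carries telescope: only the two end carries remain, whatever
  \<open>N\<close> is.\<close>

lemma dsum_step:
  "s l * dsum (Suc l) (int n * v) (n * N) + e l v = r l * n * dsum l v N + e l (v + int N)"
proof (induction N)
  case (Suc N)
  have "dsum (Suc l) (int n * v) (n * Suc N) = dsum (Suc l) (int n * v) (n * N)
      + (\<Sum>i<n. d (Suc l) (int n * (v + int N) + int i))"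
    using dsum_add[of "Suc l" "int n * v" "n * N" n]
    by (simp add: add.commute algebra_simps dsum_def[of _ _ n])
  then have "s l * dsum (Suc l) (int n * v) (n * Suc N) + e l v
      = (s l * dsum (Suc l) (int n * v) (n * N) + e l v)
        + s l * (\<Sum>i<n. d (Suc l) (int n * (v + int N) + int i))"
    by (simp add: distrib_left)
  also have "\<dots> = r l * n * dsum l v N + (e l (v + int N)
        + s l * (\<Sum>i<n. d (Suc l) (int n * (v + int N) + int i)))"
    by (simp only: Suc.IH add.assoc)
  also have "\<dots> = r l * n * dsum l v N + (r l * n * d l (v + int N) + e l (v + int N + 1))"
    using rule[of l "v + int N"] by simp
  also have "\<dots> = r l * n * dsum l v (Suc N) + e l (v + int (Suc N))"
    by (simp add: dsum_Suc distrib_left add.assoc add.commute[of 1])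
  finally show ?case .
qed simp

section \<open>Scaling over several levels\<close>

definition S :: "nat \<Rightarrow> nat" where "S l = (\<Prod>i<l. s i)"
definition R :: "nat \<Rightarrow> nat" where "R l = (\<Prod>i<l. r i * n)"

text \<open>Here \<open>i\<close> counts the levels with factor \<open>n\<close> and
  \<open>j\<close> those with factor \<open>1 / (n + 1)\<close>; the further \<open>n ^ l\<close> in
  \<open>R l\<close> is the growth of the block length.\<close>

lemma S_R_exponents:
  obtains i j where "i + j = l" "S l = (n + 1) ^ j" "R l = n ^ (l + i)"
proof -
  have "\<exists>i j. i + j = l \<and> S l = (n + 1) ^ j \<and> R l = n ^ (l + i)"
  proof (induction l)
    case 0
    then show ?case by (simp add: S_def R_def)
  next
    case (Suc l)
    then obtain i j where ij: "i + j = l" "S l = (n + 1) ^ j" "R l = n ^ (l + i)" by blast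
    from ratio[of l] show ?case
    proof
      assume "(s l, r l) = (1, n)"
      then show ?thesis using ij
        by (intro exI[of _ "Suc i"] exI[of _ j]) (simp add: S_def R_def)
    next
      assume "(s l, r l) = (n + 1, 1)"
      then show ?thesis using ij
        by (intro exI[of _ i] exI[of _ "Suc j"]) (simp add: S_def R_def)
    qed
  qed
  then show thesis using that by blast
qed

text \<open>One more level multiplies the old error by \<open>r l * n\<close> and adds at most
  \<open>S l * E\<close> from the end carries, so \<open>B\<close> is uniform in \<open>v\<close>
  and \<open>N\<close>.\<close>

lemma dsum_levels:
  "\<exists>B. \<forall>v N. \<bar>int (S l) * int (dsum l (int (n ^ l) * v) (n ^ l * N))
      - int (R l) * int (dsum 0 v N)\<bar> \<le> B"
proof (induction l)
  case 0
  then show ?case by (simp add: S_def R_def) auto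
next
  case (Suc l)
  then obtain B where B: "\<And>v N. \<bar>int (S l) * int (dsum l (int (n ^ l) * v) (n ^ l * N))
      - int (R l) * int (dsum 0 v N)\<bar> \<le> B" by blast
  have "\<bar>int (S (Suc l)) * int (dsum (Suc l) (int (n ^ Suc l) * v) (n ^ Suc l * N))
      - int (R (Suc l)) * int (dsum 0 v N)\<bar> \<le> int (r l * n) * B + int (S l) * int E" for v N
  proof -
    define f where "f = int (dsum l (int (n ^ l) * v) (n ^ l * N))"
    define f' where "f' = int (dsum (Suc l) (int (n ^ Suc l) * v) (n ^ Suc l * N))"
    define \<delta> where "\<delta> = int (e l (int (n ^ l) * v + int (n ^ l * N))) - int (e l (int (n ^ l) * v))"
    have "int (s l) * f' + int (e l (int (n ^ l) * v))
        = int (r l * n) * f + int (e l (int (n ^ l) * v + int (n ^ l * N)))"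
      using arg_cong[OF dsum_step[of l "int (n ^ l) * v" "n ^ l * N"], of int]
      by (simp add: f_def f'_def mult.assoc)
    then have step: "int (s l) * f' = int (r l * n) * f + \<delta>"
      by (simp add: \<delta>_def)
    have \<delta>: "\<bar>\<delta>\<bar> \<le> int E"
      using e_le[of l "int (n ^ l) * v + int (n ^ l * N)"] e_le[of l "int (n ^ l) * v"]
      unfolding \<delta>_def by linarith
    have "int (S (Suc l)) * f' - int (R (Suc l)) * int (dsum 0 v N)
        = int (S l) * (int (s l) * f') - int (R l) * int (r l * n) * int (dsum 0 v N)"
      by (simp add: S_def R_def)
    also have "\<dots> = int (r l * n) * (int (S l) * f - int (R l) * int (dsum 0 v N)) + int (S l) * \<delta>"
      unfolding step by (simp add: algebra_simps)
    finally have "\<bar>int (S (Suc l)) * f' - int (R (Suc l)) * int (dsum 0 v N)\<bar>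
        \<le> \<bar>int (r l * n) * (int (S l) * f - int (R l) * int (dsum 0 v N))\<bar> + \<bar>int (S l) * \<delta>\<bar>"
      by (simp only: abs_triangle_ineq)
    also have "\<dots> \<le> int (r l * n) * B + int (S l) * int E"
      unfolding abs_mult f_def by (intro add_mono mult_mono B \<delta>) auto
    finally show ?thesis by (simp only: f'_def)
  qed
  then show ?case by blast
qed

section \<open>Exclusion of periods\<close>

lemma no_common_period:
  assumes k: "k > 0"
    and d_per: "\<And>l u. d l (u + int (k * n ^ l)) = d l u"
    and e_per: "\<And>l u. e l (u + int (k * n ^ l)) = e l u"
  shows False
proof -
  define f where "f l = dsum l 0 (k * n ^ l)" for l
  \<comment> \<open>Over a full period the two end carries agree, so the scaling is exact.\<close>
  have step: "s l * f (Suc l) = r l * n * f l" for l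
    using dsum_step[of l 0 "k * n ^ l"] e_per[of l 0] by (simp add: f_def mult_ac)
  have exact: "S l * f l = R l * f 0" for l
  proof (induction l)
    case (Suc l)
    have "S (Suc l) * f (Suc l) = S l * (s l * f (Suc l))" by (simp add: S_def)
    also have "\<dots> = r l * n * (S l * f l)" unfolding step by simp
    also have "\<dots> = R (Suc l) * f 0" unfolding Suc by (simp add: R_def)
    finally show ?case .
  qed (simp add: S_def R_def)
  have f0: "f 0 > 0" using dsum_ge[of k 0 0] k by (simp add: f_def)
  \<comment> \<open>The aim is \<open>n ^ i \<le> L\<close> and
    \<open>(n + 1) ^ j \<le> f 0\<close>. At level \<open>l = f 0 * L\<close> the product of these
    bounds is \<open>l\<close> itself, too small for \<open>2 ^ (i + j) = 2 ^ l\<close>.\<close>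
  define L where "L = f 0 * (k * K)"
  obtain i j where ij: "i + j = f 0 * L" "S (f 0 * L) = (n + 1) ^ j"
    "R (f 0 * L) = n ^ (f 0 * L + i)" by (rule S_R_exponents)
  define l where "l = f 0 * L"
  have eq: "(n + 1) ^ j * f l = n ^ (l + i) * f 0"
    using exact[of l] ij by (simp add: l_def)
  have "coprime ((n + 1) ^ j) (n ^ (l + i))" by simp
  then have "(n + 1) ^ j dvd f 0"
    using eq by (metis coprime_dvd_mult_right_iff dvd_triv_left)
  then have j: "(n + 1) ^ j \<le> f 0" using f0 by (rule dvd_imp_le)
  have "n ^ l * n ^ i \<le> n ^ (l + i) * f 0" using f0 by (simp add: power_add)
  also have "\<dots> = (n + 1) ^ j * f l" using eq by simp
  also have "\<dots> \<le> f 0 * (k * n ^ l * K)"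
    using j dsum_le[of l 0 "k * n ^ l"] unfolding f_def[of l] by (rule mult_le_mono)
  also have "\<dots> = n ^ l * L" by (simp add: L_def)
  finally have i: "n ^ i \<le> L" using n_ge_2 by simp
  have "l < 2 ^ l" by (rule less_exp)
  also have "\<dots> = 2 ^ i * (2::nat) ^ j" using ij by (simp add: l_def flip: power_add)
  also have "\<dots> \<le> n ^ i * (n + 1) ^ j" using n_ge_2 by (intro mult_le_mono power_mono) auto
  also have "\<dots> \<le> L * f 0" using i j by (rule mult_le_mono)
  also have "\<dots> = l" by (simp add: l_def)
  finally show False by simp
qed

lemma no_level_period:
  assumes M: "M > 0" and per: "\<And>u. d M u = d 0 (u + k)"
  shows False
proof -
  define Q where "Q = n ^ M"
  obtain i j where ij: "i + j = M" "S M = (n + 1) ^ j" "R M = n ^ (M + i)" by (rule S_R_exponents)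
  \<comment> \<open>Coprime powers agree only if both are \<open>1\<close>, which forces
    \<open>i = j = 0\<close>.\<close>
  have "n ^ i \<noteq> (n + 1) ^ j"
  proof
    assume eq: "n ^ i = (n + 1) ^ j"
    have "coprime (n ^ i) ((n + 1) ^ j)" by simp
    then have "n ^ i = 1" "(n + 1) ^ j = 1" unfolding eq by simp_all
    then show False using ij(1) M n_ge_2 by auto
  qed
  then have neq: "S M * Q \<noteq> R M" using ij n_ge_2 by (simp add: Q_def power_add)
  have S_pos: "S M > 0" and Q_pos: "Q > 0" using ij n_ge_2 by (simp_all add: Q_def)
  have shift: "dsum M w N = dsum 0 (w + k) N" for w N
    by (simp add: dsum_def per algebra_simps)
  obtain B where B: "\<And>v N. \<bar>int (S M) * int (dsum M (int (n ^ M) * v) (n ^ M * N))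
      - int (R M) * int (dsum 0 v N)\<bar> \<le> B" using dsum_levels[of M] by blast
  \<comment> \<open>Digits are positive, so a block this long has sum at least \<open>2 * B\<close>,
    and the error \<open>B\<close> is at most half the sum.\<close>
  define N0 where "N0 = nat (2 * B) + 1"
  \<comment> \<open>The block over \<open>w\<close> starts at \<open>int Q * w\<close> on level
    \<open>M\<close>; the period identifies it with a block on level \<open>0\<close>, shifted by
    \<open>k\<close>. Iteration yields blocks on level \<open>0\<close> whose lengths grow by the
    factor \<open>Q\<close>.\<close>
  define v where "v i = ((\<lambda>w. int Q * w + k) ^^ i) 0" for i
  define g where "g i = real (dsum 0 (v i) (Q ^ i * N0))" for i
  have N: "real (Q ^ i * N0) \<ge> 2 * real_of_int B" for i
  proof -
    have "1 * N0 \<le> Q ^ i * N0" using Q_pos by (intro mult_le_mono1) (simp add: Suc_leI)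
    moreover have "2 * B \<le> int N0" by (simp add: N0_def)
    ultimately have "2 * B \<le> int (Q ^ i * N0)" by linarith
    then have "real_of_int (2 * B) \<le> real_of_int (int (Q ^ i * N0))" by (simp only: of_int_le_iff)
    then show ?thesis by simp
  qed
  have g_ge: "g i \<ge> real (Q ^ i * N0)" for i
    unfolding g_def using dsum_ge by (simp only: of_nat_le_iff)
  have g_le: "g i \<le> real (Q ^ i * N0) * real K" for i
    unfolding g_def using dsum_le[of 0 "v i" "Q ^ i * N0"] by (simp only: of_nat_le_iff flip: of_nat_mult)
  have step: "\<bar>real (S M) * g (Suc i) - real (R M) * g i\<bar> \<le> g i / 2" for i
  proof -
    have "\<bar>int (S M) * int (dsum 0 (v (Suc i)) (Q ^ Suc i * N0))
      - int (R M) * int (dsum 0 (v i) (Q ^ i * N0))\<bar> \<le> B"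
      using B[of "v i" "Q ^ i * N0"] unfolding shift by (simp add: v_def Q_def mult.assoc)
    then have "real_of_int \<bar>int (S M) * int (dsum 0 (v (Suc i)) (Q ^ Suc i * N0))
      - int (R M) * int (dsum 0 (v i) (Q ^ i * N0))\<bar> \<le> real_of_int B" by (simp only: of_int_le_iff)
    then have "\<bar>real (S M) * g (Suc i) - real (R M) * g i\<bar> \<le> real_of_int B"
      by (simp add: g_def)
    then show ?thesis using N[of i] g_ge[of i] by linarith
  qed
  define a where "a i = g i / real (Q ^ i * N0)" for i
  have N0_pos: "N0 > 0" by (simp add: N0_def)
  have a_ge: "a i \<ge> 1" and a_le: "a i \<le> real K" for i
    using g_ge[of i] g_le[of i] N0_pos Q_pos by (simp_all add: a_def field_simps)
  have a_step: "\<bar>real (S M * Q) * a (Suc i) - real (R M) * a i\<bar> \<le> a i / 2" for i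
  proof -
    have "real (S M * Q) * a (Suc i) - real (R M) * a i
      = (real (S M) * g (Suc i) - real (R M) * g i) / real (Q ^ i * N0)"
      using N0_pos Q_pos by (simp add: a_def field_simps)
    then show ?thesis
      using divide_right_mono[OF step, of "real (Q ^ i * N0)" i]
      by (simp add: a_def abs_divide)
  qed
  have SQ: "real (S M * Q) > 0" using S_pos Q_pos by simp
  show False
  proof (cases "S M * Q < R M")
    case True
    \<comment> \<open>\<open>S M * Q\<close> and \<open>R M\<close> are distinct integers, so an
      error of one half keeps the growth factor strictly on its side of \<open>1\<close>.\<close>
    define \<gamma> where "\<gamma> = (real (R M) - 1 / 2) / real (S M * Q)"
    have "real (S M * Q) + 1 \<le> real (R M)" using True by linarith
    then have \<gamma>: "\<gamma> > 1" using SQ unfolding \<gamma>_def by (simp add: less_divide_eq del: of_nat_mult)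
    have "\<gamma> * a i \<le> a (Suc i)" for i
      using a_step[of i] SQ by (simp add: \<gamma>_def field_simps del: of_nat_mult) argo
    then have "\<gamma> ^ i \<le> a i" for i
    proof (induction i)
      case (Suc i)
      have "\<gamma> ^ Suc i \<le> \<gamma> * a i" using Suc \<gamma> by simp
      also have "\<dots> \<le> a (Suc i)" by fact
      finally show ?case .
    qed (use a_ge in simp)
    moreover obtain i where "real K < \<gamma> ^ i" using real_arch_pow[OF \<gamma>] by blast
    ultimately show False using a_le[of i] by (meson leD order_trans)
  next
    case False
    define \<gamma> where "\<gamma> = (real (R M) + 1 / 2) / real (S M * Q)"
    have "real (S M * Q) \<ge> real (R M) + 1" using False neq by linarith
    then have \<gamma>: "\<gamma> < 1" "\<gamma> > 0" using SQ unfolding \<gamma>_def by (simp_all add: divide_less_eq del: of_nat_mult)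
    have "a (Suc i) \<le> \<gamma> * a i" for i
      using a_step[of i] SQ by (simp add: \<gamma>_def field_simps del: of_nat_mult) argo
    then have *: "a i \<le> \<gamma> ^ i * real K" for i
    proof (induction i)
      case (Suc i)
      have "a (Suc i) \<le> \<gamma> * a i" by fact
      also have "\<dots> \<le> \<gamma> ^ Suc i * real K" using Suc \<gamma> by simp
      finally show ?case .
    qed (use a_le in simp)
    have K: "real K > 0" using a_ge[of 0] a_le[of 0] by linarith
    then obtain i where "\<gamma> ^ i < 1 / real K" using real_arch_pow_inv[of "1 / real K" \<gamma>] \<gamma> by auto
    then have "\<gamma> ^ i * real K < 1" using K by (simp add: field_simps)
    then show False using *[of i] a_ge[of i] by linarith
  qed
qed

end


section \<open>A group generated by \<open>a\<close> and \<open>b\<close> with \<open>b a = a\<^sup>n b\<close>\<close>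

locale bs_group = group G for G (structure) +
  fixes a b and n :: nat
  assumes a_closed [simp]: "a \<in> carrier G" and b_closed [simp]: "b \<in> carrier G"
    and rel: "b \<otimes> a = a [^] n \<otimes> b"
begin

lemma inv_mult_cancel:
  assumes "x \<in> carrier G" "y \<in> carrier G"
  shows "inv x \<otimes> (x \<otimes> y) = y" "x \<otimes> (inv x \<otimes> y) = y"
  using assms by (simp_all flip: m_assoc)

text \<open>Passing to the parent multiplies positions by \<open>n\<close>. Exponents are integers
  because cosets extend in both directions.\<close>

lemma a_pow_b_inv: "a [^] (k::int) \<otimes> inv b = inv b \<otimes> a [^] (int n * k)"
proof -
  have "a \<otimes> inv b = inv b \<otimes> (b \<otimes> a) \<otimes> inv b" by (simp add: m_assoc inv_mult_cancel)
  also have "\<dots> = inv b \<otimes> a [^] n" unfolding rel by (simp add: m_assoc)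
  finally have base: "a \<otimes> inv b = inv b \<otimes> a [^] n" .
  have nat: "a [^] m \<otimes> inv b = inv b \<otimes> (a [^] n) [^] m" for m :: nat
  proof (induction m)
    case (Suc m)
    have "a [^] Suc m \<otimes> inv b = a [^] m \<otimes> (a \<otimes> inv b)" by (simp add: m_assoc)
    also have "\<dots> = (a [^] m \<otimes> inv b) \<otimes> a [^] n" by (simp add: base m_assoc)
    also have "\<dots> = inv b \<otimes> (a [^] n) [^] Suc m" by (simp add: Suc m_assoc)
    finally show ?case .
  qed simp
  show ?thesis
  proof (cases "k \<ge> 0")
    case True
    then obtain m where "k = int m" by (metis nonneg_int_cases)
    then show ?thesis using nat[of m] by (simp add: int_pow_int nat_pow_pow flip: of_nat_mult)
  next
    case False
    then obtain m where k: "k = - int m" by (metis nonneg_int_cases linear neg_0_le_iff_le minus_minus)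
    have y: "int n * k = - int (n * m)" by (simp add: k)
    have "inv (a [^] m) \<otimes> (a [^] m \<otimes> inv b) \<otimes> inv (a [^] (n * m))
        = inv (a [^] m) \<otimes> (inv b \<otimes> a [^] (n * m)) \<otimes> inv (a [^] (n * m))"
      by (simp add: nat nat_pow_pow)
    then have "inv b \<otimes> inv (a [^] (n * m)) = inv (a [^] m) \<otimes> inv b"
      by (simp add: m_assoc inv_mult_cancel)
    then show ?thesis unfolding y unfolding k by (simp only: int_pow_neg_int a_closed)
  qed
qed

lemma b_a_pow: "b \<otimes> a [^] (k::int) = a [^] (int n * k) \<otimes> b"
proof -
  have "b \<otimes> a [^] k = b \<otimes> (a [^] k \<otimes> inv b) \<otimes> b" by (simp add: m_assoc)
  also have "\<dots> = a [^] (int n * k) \<otimes> b"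
    unfolding a_pow_b_inv by (simp add: m_assoc inv_mult_cancel)
  finally show ?thesis .
qed

section \<open>Ancestors of a coset\<close>

text \<open>Position \<open>u\<close> on the \<open>l\<close>-th ancestor of the subgroup generated
  by \<open>a\<close>; left multiplication by \<open>g\<close> gives the ancestors of its coset by
  \<open>g\<close>.\<close>

definition line :: "nat \<Rightarrow> int \<Rightarrow> 'a" where
  "line l u = inv b [^] l \<otimes> a [^] u"

lemma line_closed [simp]: "line l u \<in> carrier G"
  by (simp add: line_def)

lemma line_a: "line l u \<otimes> a = line l (u + 1)"
  by (simp add: line_def m_assoc int_pow_mult)

lemma line_b_inv: "line l u \<otimes> (inv b \<otimes> a [^] i) = line (Suc l) (int n * u + int i)"
proof -
  have "line l u \<otimes> (inv b \<otimes> a [^] i) = inv b [^] l \<otimes> (a [^] u \<otimes> inv b) \<otimes> a [^] int i"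
    by (simp add: line_def m_assoc int_pow_int)
  then show ?thesis
    by (simp only: a_pow_b_inv) (simp add: line_def m_assoc int_pow_mult)
qed

text \<open>Each crossing of \<open>inv b\<close> multiplies the exponent by \<open>n\<close>; hence
  a period \<open>a [^] k\<close> becomes the period \<open>k * n ^ l\<close> of
  \<open>no_common_period\<close>.\<close>

lemma a_pow_line: "a [^] (k::int) \<otimes> line l u = line l (u + k * int (n ^ l))"
proof -
  have "a [^] k \<otimes> inv b [^] l = inv b [^] l \<otimes> a [^] (k * int (n ^ l))"
  proof (induction l)
    case (Suc l)
    have "a [^] k \<otimes> inv b [^] Suc l = (a [^] k \<otimes> inv b [^] l) \<otimes> inv b"
      by (simp add: m_assoc)
    also have "\<dots> = inv b [^] l \<otimes> (a [^] (k * int (n ^ l)) \<otimes> inv b)"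
      unfolding Suc by (simp add: m_assoc)
    also have "\<dots> = inv b [^] Suc l \<otimes> a [^] (k * int (n ^ Suc l))"
      unfolding a_pow_b_inv by (simp add: m_assoc mult_ac)
    finally show ?case .
  qed simp
  then have "a [^] k \<otimes> line l u = inv b [^] l \<otimes> (a [^] (k * int (n ^ l)) \<otimes> a [^] u)"
    by (simp add: line_def flip: m_assoc)
  then show ?thesis by (simp add: line_def add.commute flip: int_pow_mult)
qed

section \<open>Normal forms\<close>

text \<open>A period in this form compares the ancestors number \<open>i\<close> and
  \<open>j\<close> of one coset, displaced by \<open>k\<close>.\<close>

definition normal_forms :: "'a set" where
  "normal_forms = {inv b [^] i \<otimes> a [^] k \<otimes> b [^] j | (i::nat) (k::int) (j::nat). True}"

lemma b_pow_a_pow: "b [^] (j::nat) \<otimes> a [^] (k::int) = a [^] (int (n ^ j) * k) \<otimes> b [^] j"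
proof (induction j arbitrary: k)
  case (Suc j)
  have "b [^] Suc j \<otimes> a [^] k = b [^] j \<otimes> (b \<otimes> a [^] k)" by (simp add: m_assoc)
  also have "\<dots> = (b [^] j \<otimes> a [^] (int n * k)) \<otimes> b" by (simp add: b_a_pow m_assoc)
  also have "\<dots> = a [^] (int (n ^ Suc j) * k) \<otimes> b [^] Suc j" by (simp add: Suc m_assoc mult_ac)
  finally show ?case .
qed simp

lemma one_normal_form: "\<one> \<in> normal_forms"
  unfolding normal_forms_def by (intro CollectI exI[of _ 0]) simp

text \<open>A power of \<open>a\<close> moves left through \<open>b [^] j\<close>;
  \<open>inv b\<close> cancels the last \<open>b\<close> or, if \<open>j = 0\<close>, moves left
  through \<open>a [^] k\<close>.\<close>

lemma normal_forms_mult: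
  assumes "x \<in> normal_forms"
  shows "x \<otimes> a [^] (c::int) \<in> normal_forms" "x \<otimes> b \<in> normal_forms" "x \<otimes> inv b \<in> normal_forms"
proof -
  obtain i j :: nat and k :: int where x: "x = inv b [^] i \<otimes> a [^] k \<otimes> b [^] j"
    using assms by (auto simp: normal_forms_def)
  have "x \<otimes> a [^] c = inv b [^] i \<otimes> a [^] k \<otimes> (b [^] j \<otimes> a [^] c)" by (simp add: x m_assoc)
  also have "\<dots> = inv b [^] i \<otimes> (a [^] k \<otimes> a [^] (int (n ^ j) * c)) \<otimes> b [^] j"
    unfolding b_pow_a_pow by (simp add: m_assoc)
  finally have "x \<otimes> a [^] c = inv b [^] i \<otimes> a [^] (k + int (n ^ j) * c) \<otimes> b [^] j"
    by (simp add: int_pow_mult)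
  then show "x \<otimes> a [^] c \<in> normal_forms" unfolding normal_forms_def by blast
  have "x \<otimes> b = inv b [^] i \<otimes> a [^] k \<otimes> b [^] Suc j" by (simp add: x m_assoc)
  then show "x \<otimes> b \<in> normal_forms" unfolding normal_forms_def by blast
  show "x \<otimes> inv b \<in> normal_forms"
  proof (cases j)
    case 0
    then have "x \<otimes> inv b = inv b [^] i \<otimes> (a [^] k \<otimes> inv b)" by (simp add: x m_assoc)
    also have "\<dots> = inv b [^] Suc i \<otimes> a [^] (int n * k) \<otimes> b [^] (0::nat)"
      unfolding a_pow_b_inv by (simp add: m_assoc)
    finally show ?thesis unfolding normal_forms_def by blast
  next
    case (Suc j')
    then have "x \<otimes> inv b = inv b [^] i \<otimes> a [^] k \<otimes> b [^] j'" by (simp add: x m_assoc)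
    then show ?thesis unfolding normal_forms_def by blast
  qed
qed

end

section \<open>The subshift\<close>

text \<open>Scaling tag, digit and carry are packed by pairing, as the alphabet is to be a set of
  natural numbers.\<close>

definition tag :: "nat \<Rightarrow> nat" where "tag v = fst (prod_decode v)"
definition digit :: "nat \<Rightarrow> nat" where "digit v = fst (prod_decode (snd (prod_decode v)))"
definition carry :: "nat \<Rightarrow> nat" where "carry v = snd (prod_decode (snd (prod_decode v)))"
definition letter :: "nat \<Rightarrow> nat \<Rightarrow> nat \<Rightarrow> nat" where
  "letter t d e = prod_encode (t, prod_encode (d, e))"

lemma letter_simps [simp]:
  "tag (letter t d e) = t" "digit (letter t d e) = d" "carry (letter t d e) = e"
  by (simp_all add: tag_def digit_def carry_def letter_def)

definition letters :: "nat \<Rightarrow> nat \<Rightarrow> nat \<Rightarrow> nat set" where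
  "letters T K E = (\<lambda>(t, d, e). letter t d e) ` ({..T} \<times> {1..K} \<times> {..E})"

lemma finite_letters: "finite (letters T K E)"
  by (simp add: letters_def)

lemma letter_in_letters: "t \<le> T \<Longrightarrow> 1 \<le> d \<Longrightarrow> d \<le> K \<Longrightarrow> e \<le> E \<Longrightarrow> letter t d e \<in> letters T K E"
  by (force simp: letters_def)

lemma letters_bounds:
  "v \<in> letters T K E \<Longrightarrow> tag v \<le> T \<and> 1 \<le> digit v \<and> digit v \<le> K \<and> carry v \<le> E"
  by (auto simp: letters_def)

text \<open>The forbidden patterns are the finitely many maps on \<open>W\<close> violating
  \<open>P\<close>. A shift by \<open>g\<close> reads \<open>x\<close> at
  \<open>inv g \<otimes> h\<close>, and inversion permutes the group.\<close>

lemma (in group) is_SFT_local_rule: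
  assumes "finite A" "finite W" "W \<subseteq> carrier G"
  shows "is_SFT G A {x \<in> configurations G A. \<forall>g\<in>carrier G. P (\<lambda>h\<in>W. x (g \<otimes> h))}"
  unfolding is_SFT_def
proof (intro exI conjI)
  let ?F = "{W} \<times> {p \<in> W \<rightarrow>\<^sub>E A. \<not> P p}"
  have "finite (W \<rightarrow>\<^sub>E A)" using assms by (intro finite_PiE) auto
  then show "finite ?F" by simp
  show "?F \<subseteq> patterns G A" using assms by (auto simp: patterns_def)
  have "(\<forall>g\<in>carrier G. P (\<lambda>h\<in>W. x (g \<otimes> h))) \<longleftrightarrow> (\<forall>p\<in>?F. \<not> appears G A p x)"
    if x: "x \<in> configurations G A" for x
  proof -
    have window: "(\<lambda>h\<in>W. x (g \<otimes> h)) \<in> W \<rightarrow>\<^sub>E A" if "g \<in> carrier G" for g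
      using x that assms(3) by (auto simp: configurations_def)
    have shift: "shift G A g x h = x (inv g \<otimes> h)" if "h \<in> W" for g h
      using x that assms(3) by (auto simp: shift_def)
    have appears: "appears G A (W, p) x \<longleftrightarrow> (\<exists>g\<in>carrier G. p = (\<lambda>h\<in>W. x (g \<otimes> h)))"
      if p: "p \<in> W \<rightarrow>\<^sub>E A" for p
    proof
      assume "appears G A (W, p) x"
      then obtain g where g: "g \<in> carrier G" "\<forall>h\<in>W. x (inv g \<otimes> h) = p h"
        using shift by (auto simp: appears_def)
      then have "p = (\<lambda>h\<in>W. x (inv g \<otimes> h))" using p by (intro ext) (auto simp: PiE_def extensional_def)
      then show "\<exists>g\<in>carrier G. p = (\<lambda>h\<in>W. x (g \<otimes> h))" using g(1) by blast
    next
      assume "\<exists>g\<in>carrier G. p = (\<lambda>h\<in>W. x (g \<otimes> h))"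
      then obtain g where g: "g \<in> carrier G" "p = (\<lambda>h\<in>W. x (g \<otimes> h))" by blast
      then have "\<forall>h\<in>W. shift G A (inv g) x h = p h" by (simp add: shift)
      then show "appears G A (W, p) x" using g(1) by (auto simp: appears_def)
    qed
    show ?thesis using window appears by blast
  qed
  then show "{x \<in> configurations G A. \<forall>g\<in>carrier G. P (\<lambda>h\<in>W. x (g \<otimes> h))}
      = {x \<in> configurations G A. \<forall>p\<in>?F. \<not> appears G A p x}" by blast
qed

text \<open>\<open>num / den\<close> is the factor from a coset to its parent: \<open>n\<close> or
  \<open>1 / (n + 1)\<close>.\<close>

definition den :: "nat \<Rightarrow> nat \<Rightarrow> nat" where "den n t = (if t = 0 then 1 else n + 1)"
definition num :: "nat \<Rightarrow> nat \<Rightarrow> nat" where "num n t = (if t = 0 then n else 1)"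

section \<open>The subshift and its aperiodicity\<close>

context bs_group
begin

text \<open>A position, its right neighbour and its block in the parent coset.\<close>

definition window :: "'a set" where
  "window = {\<one>, a} \<union> (\<lambda>i. inv b \<otimes> a [^] i) ` {..<n}"

definition local_rule :: "('a \<Rightarrow> nat) \<Rightarrow> bool" where
  "local_rule p \<longleftrightarrow> tag (p a) = tag (p \<one>) \<and>
    den n (tag (p \<one>)) * (\<Sum>i<n. digit (p (inv b \<otimes> a [^] i))) + carry (p \<one>)
      = num n (tag (p \<one>)) * n * digit (p \<one>) + carry (p a)"

text \<open>The bounds fit the configuration built below: slopes up to \<open>n * (n + 1)\<close>,
  offset carries up to \<open>n * n + n + 1\<close>.\<close>

definition alphabet :: "nat set" where
  "alphabet = letters 1 (n * (n + 1)) (n * n + n + 1)"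

definition kari :: "('a \<Rightarrow> nat) set" where
  "kari = {x \<in> configurations G alphabet. \<forall>g\<in>carrier G. local_rule (\<lambda>h\<in>window. x (g \<otimes> h))}"

lemma is_SFT_kari: "is_SFT G alphabet kari"
  unfolding kari_def
  by (rule is_SFT_local_rule) (auto simp: alphabet_def finite_letters window_def)

lemma local_rule_window:
  assumes "g \<in> carrier G"
  shows "local_rule (\<lambda>h\<in>window. x (g \<otimes> h)) \<longleftrightarrow> tag (x (g \<otimes> a)) = tag (x g) \<and>
    den n (tag (x g)) * (\<Sum>i<n. digit (x (g \<otimes> (inv b \<otimes> a [^] i)))) + carry (x g)
      = num n (tag (x g)) * n * digit (x g) + carry (x (g \<otimes> a))"
proof -
  have "(\<Sum>i<n. digit ((\<lambda>h\<in>window. x (g \<otimes> h)) (inv b \<otimes> a [^] i)))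
      = (\<Sum>i<n. digit (x (g \<otimes> (inv b \<otimes> a [^] i))))"
    by (intro sum.cong) (auto simp: window_def)
  moreover have "\<one> \<in> window" "a \<in> window" by (simp_all add: window_def)
  ultimately show ?thesis using assms by (simp add: local_rule_def)
qed

text \<open>Neighbouring tags agree, so a coset has a single tag, which may be read at position
  \<open>0\<close>.\<close>

lemma kari_digit_lines:
  assumes n: "n \<ge> 2" and x: "x \<in> kari" and g: "g \<in> carrier G"
  shows "digit_lines n (n * (n + 1)) (n * n + n + 1)
    (\<lambda>l. den n (tag (x (g \<otimes> line l 0)))) (\<lambda>l. num n (tag (x (g \<otimes> line l 0))))
    (\<lambda>l u. digit (x (g \<otimes> line l u))) (\<lambda>l u. carry (x (g \<otimes> line l u)))"
proof
  have mem: "x h \<in> alphabet" if "h \<in> carrier G" for h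
    using x that by (auto simp: kari_def configurations_def)
  fix l u
  note bounds = letters_bounds[OF mem[unfolded alphabet_def], of "g \<otimes> line l u"]
  show "1 \<le> digit (x (g \<otimes> line l u))" "digit (x (g \<otimes> line l u)) \<le> n * (n + 1)"
    "carry (x (g \<otimes> line l u)) \<le> n * n + n + 1" using bounds g by auto
  have rule: "tag (x (g \<otimes> line l u \<otimes> a)) = tag (x (g \<otimes> line l u)) \<and>
    den n (tag (x (g \<otimes> line l u))) * (\<Sum>i<n. digit (x (g \<otimes> line l u \<otimes> (inv b \<otimes> a [^] i))))
        + carry (x (g \<otimes> line l u))
      = num n (tag (x (g \<otimes> line l u))) * n * digit (x (g \<otimes> line l u))
        + carry (x (g \<otimes> line l u \<otimes> a))" for u
    using x g by (subst local_rule_window[symmetric]) (auto simp: kari_def)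
  have step: "tag (x (g \<otimes> line l (u + 1))) = tag (x (g \<otimes> line l u))" for u
    using rule[of u] g by (simp add: m_assoc line_a)
  have tag: "tag (x (g \<otimes> line l u)) = tag (x (g \<otimes> line l 0))"
  proof (induction u rule: int_induct[of _ 0])
    case (step2 i)
    then show ?case using step[of "i - 1"] by simp
  qed (simp_all add: step)
  show "den n (tag (x (g \<otimes> line l 0)))
        * (\<Sum>i<n. digit (x (g \<otimes> line (Suc l) (int n * u + int i)))) + carry (x (g \<otimes> line l u))
      = num n (tag (x (g \<otimes> line l 0))) * n * digit (x (g \<otimes> line l u))
        + carry (x (g \<otimes> line l (u + 1)))"
    using rule[of u] g by (simp add: m_assoc line_a line_b_inv tag)
qed (use n in \<open>auto simp: den_def num_def\<close>)

text \<open>Cancelling \<open>b [^] j\<close> on the right turns the period into an equality between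
  ancestors \<open>i\<close> and \<open>j\<close>. For \<open>i \<noteq> j\<close> it is a level
  period seen from the lower one; for \<open>i = j\<close> it is a common period of all further
  ancestors.\<close>

lemma kari_period_trivial:
  assumes n: "n \<ge> 2" and x: "x \<in> kari"
    and per: "\<And>h. h \<in> carrier G \<Longrightarrow> x (inv b [^] (i::nat) \<otimes> a [^] (k::int) \<otimes> b [^] (j::nat) \<otimes> h) = x h"
  shows "i = j \<and> k = 0"
proof -
  have per': "x (inv b [^] i \<otimes> (a [^] k \<otimes> h)) = x (inv b [^] j \<otimes> h)" if "h \<in> carrier G" for h
    using per[of "inv b [^] j \<otimes> h"] that
    by (simp add: m_assoc nat_pow_inv inv_mult_cancel)
  have lines: "x (inv b [^] i \<otimes> line l (u + k * int (n ^ l))) = x (inv b [^] j \<otimes> line l u)" for l u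
    using per'[of "line l u"] by (simp add: a_pow_line)
  have add_level: "inv b [^] q \<otimes> line l u = line (q + l) u" for q l :: nat and u
    by (simp add: line_def nat_pow_mult flip: m_assoc)
  have "i = j"
  proof (rule ccontr)
    assume "i \<noteq> j"
    then consider "i < j" | "j < i" by linarith
    then show False
    proof cases
      case 1
      interpret digit_lines n "n * (n + 1)" "n * n + n + 1"
        "\<lambda>l. den n (tag (x (inv b [^] i \<otimes> line l 0)))" "\<lambda>l. num n (tag (x (inv b [^] i \<otimes> line l 0)))"
        "\<lambda>l u. digit (x (inv b [^] i \<otimes> line l u))" "\<lambda>l u. carry (x (inv b [^] i \<otimes> line l u))"
        using n x by (rule kari_digit_lines) simp
      show False
        by (rule no_level_period[of "j - i" k]) (use lines[of 0] 1 in \<open>simp_all add: add_level\<close>)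
    next
      case 2
      interpret digit_lines n "n * (n + 1)" "n * n + n + 1"
        "\<lambda>l. den n (tag (x (inv b [^] j \<otimes> line l 0)))" "\<lambda>l. num n (tag (x (inv b [^] j \<otimes> line l 0)))"
        "\<lambda>l u. digit (x (inv b [^] j \<otimes> line l u))" "\<lambda>l u. carry (x (inv b [^] j \<otimes> line l u))"
        using n x by (rule kari_digit_lines) simp
      \<comment> \<open>Now ancestor \<open>j\<close> is the base level, so the displacement changes
        sign.\<close>
      show False
        by (rule no_level_period[of "i - j" "- k"])
          (use lines[of 0 "_ - k"] 2 in \<open>simp_all add: add_level\<close>)
    qed
  qed
  moreover have "k = 0"
  proof (rule ccontr)
    assume k: "k \<noteq> 0"
    interpret digit_lines n "n * (n + 1)" "n * n + n + 1"
      "\<lambda>l. den n (tag (x (inv b [^] i \<otimes> line l 0)))" "\<lambda>l. num n (tag (x (inv b [^] i \<otimes> line l 0)))"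
      "\<lambda>l u. digit (x (inv b [^] i \<otimes> line l u))" "\<lambda>l u. carry (x (inv b [^] i \<otimes> line l u))"
      using n x by (rule kari_digit_lines) simp
    have "x (inv b [^] i \<otimes> line l (u + int (nat \<bar>k\<bar> * n ^ l))) = x (inv b [^] i \<otimes> line l u)" for l u
      using lines[of l u] lines[of l "u - k * int (n ^ l)"] \<open>i = j\<close>
      by (cases "k \<ge> 0") (simp_all del: of_nat_power)
    then show False using no_common_period[of "nat \<bar>k\<bar>"] k by simp
  qed
  ultimately show ?thesis by blast
qed

lemma kari_not_weakly_periodic:
  assumes n: "n \<ge> 2" and gen: "carrier G \<subseteq> normal_forms" and x: "x \<in> kari"
  shows "\<not> weakly_periodic G alphabet x"
proof -
  have conf: "x \<in> configurations G alphabet" using x by (simp add: kari_def)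
  interpret act: group_action G "configurations G alphabet" "shift G alphabet"
    by (rule group_action_shift) (rule group_axioms)
  have "g = \<one>" if "g \<in> stabilizer G (shift G alphabet) x" for g
  proof -
    have g: "g \<in> carrier G" and fix_x: "shift G alphabet g x = x"
      using that by (auto simp: stabilizer_def)
    \<comment> \<open>The shift by \<open>g\<close> reads \<open>x\<close> at
      \<open>inv g \<otimes> h\<close>, so \<open>inv g\<close> is put in normal form.\<close>
    obtain i j :: nat and k :: int where nf: "inv g = inv b [^] i \<otimes> a [^] k \<otimes> b [^] j"
      using gen inv_closed[OF g] by (auto simp: normal_forms_def)
    have "x (inv g \<otimes> h) = x h" if "h \<in> carrier G" for h
      using fun_cong[OF fix_x, of h] that conf by (simp add: shift_def)
    then have "i = j \<and> k = 0" unfolding nf using n x by (intro kari_period_trivial)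
    then have "inv g = \<one>" unfolding nf by (simp add: nat_pow_inv)
    then show ?thesis using g by simp
  qed
  moreover have "\<one> \<in> stabilizer G (shift G alphabet) x"
    using conf by (rule act.stabilizer_one_closed)
  ultimately show ?thesis unfolding weakly_periodic_def by blast
qed

end

section \<open>A configuration\<close>

text \<open>Levels are unbounded both ways, so chosen successors and predecessors are iterated from
  \<open>x0\<close>.\<close>

lemma bi_infinite_orbit:
  assumes "x0 \<in> X" and "\<And>x. x \<in> X \<Longrightarrow> \<exists>y\<in>X. Q x y" and "\<And>y. y \<in> X \<Longrightarrow> \<exists>x\<in>X. Q x y"
  obtains f :: "int \<Rightarrow> 'a" where "\<And>m. f m \<in> X" "\<And>m. Q (f m) (f (m + 1))"
proof -
  obtain p where p: "\<And>x. x \<in> X \<Longrightarrow> p x \<in> X \<and> Q x (p x)" using assms(2) by metis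
  obtain q where q: "\<And>x. x \<in> X \<Longrightarrow> q x \<in> X \<and> Q (q x) x" using assms(3) by metis
  define f where "f m = (if m \<ge> 0 then (p ^^ nat m) x0 else (q ^^ nat (- m)) x0)" for m
  have pX: "(p ^^ i) x0 \<in> X" for i by (induction i) (use assms(1) p in auto)
  have qX: "(q ^^ i) x0 \<in> X" for i by (induction i) (use assms(1) q in auto)
  have "Q (f m) (f (m + 1))" for m
  proof (cases "m \<ge> 0")
    case True
    then show ?thesis using p[OF pX, of "nat m"] by (simp add: f_def nat_add_distrib)
  next
    case False
    define i where "i = nat (- m - 1)"
    have m: "m = - int (Suc i)" using False by (simp add: i_def)
    have "f (m + 1) = (q ^^ i) x0" by (cases "i = 0") (simp_all add: f_def m)
    then show ?thesis using q[OF qX, of i] by (simp add: f_def m nat_add_distrib)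
  qed
  then show thesis using that[of f] pX qX by (simp add: f_def)
qed

text \<open>Forward, divide by \<open>n\<close> from \<open>n\<close> on and multiply by
  \<open>n + 1\<close> below it; backward, divide by \<open>n + 1\<close> from \<open>n + 1\<close>
  on and multiply by \<open>n\<close> below it. Both choices stay in the interval.\<close>

lemma scaling_orbit:
  assumes n: "n \<ge> (2::nat)"
  obtains x :: "int \<Rightarrow> real" where "\<And>m. 1 \<le> x m \<and> x m \<le> real (n * (n + 1))"
    "\<And>m. x m = real n * x (m + 1) \<or> real (n + 1) * x m = x (m + 1)"
proof -
  let ?X = "{1..real (n * (n + 1))}"
  let ?Q = "\<lambda>x y. x = real n * y \<or> real (n + 1) * x = y"
  have forward: "\<exists>y\<in>?X. ?Q x y" if "x \<in> ?X" for x
  proof (cases "x \<ge> n")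
    case True
    have "x / n \<le> x" using that n by (simp add: field_simps)
    then show ?thesis using that True n by (intro bexI[of _ "x / n"]) auto
  next
    case False
    have "real (n + 1) * x \<le> real (n + 1) * real n" using False by (intro mult_left_mono) auto
    moreover have "1 * 1 \<le> real (n + 1) * x" using that by (intro mult_mono) auto
    ultimately show ?thesis by (intro bexI[of _ "(n + 1) * x"]) (auto simp: algebra_simps)
  qed
  have backward: "\<exists>x\<in>?X. ?Q x y" if "y \<in> ?X" for y
  proof (cases "y \<ge> n + 1")
    case True
    have "y / (n + 1) \<le> y" using that n by (simp add: field_simps)
    then show ?thesis using that True n by (intro bexI[of _ "y / (n + 1)"]) auto
  next
    case False
    have "real n * y \<le> real n * real (n + 1)" using False by (intro mult_left_mono) auto
    moreover have "1 * 1 \<le> real n * y" using that n by (intro mult_mono) auto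
    ultimately show ?thesis by (intro bexI[of _ "n * y"]) (auto simp: algebra_simps)
  qed
  have one: "1 \<in> ?X" using n by (simp flip: of_nat_mult del: mult_Suc_right)
  show thesis
  proof (rule bi_infinite_orbit[of 1 ?X ?Q, OF one forward backward])
    fix f :: "int \<Rightarrow> real"
    assume "\<And>m. f m \<in> ?X" "\<And>m. ?Q (f m) (f (m + 1))"
    then show thesis by (intro that[of f]) auto
  qed
qed

section \<open>Beatty sequences with carries\<close>

text \<open>All cosets on level \<open>m\<close> share the slope \<open>x m\<close>. The position
  \<open>z\<close> is real because \<open>b\<close> divides it by \<open>n\<close>, giving cosets
  different fractional offsets.\<close>

definition level_digit :: "(int \<Rightarrow> real) \<Rightarrow> real \<times> int \<Rightarrow> int" where
  "level_digit x = (\<lambda>(z, m). \<lfloor>x m * (z + 1)\<rfloor> - \<lfloor>x m * z\<rfloor>)"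

text \<open>The parent level is \<open>m - 1\<close>, as \<open>inv b\<close> lowers the
  level.\<close>

definition level_tag :: "nat \<Rightarrow> (int \<Rightarrow> real) \<Rightarrow> int \<Rightarrow> nat" where
  "level_tag n x m = (if x (m - 1) = real n * x m then 0 else 1)"

text \<open>The offset \<open>n + 1\<close> only makes the carry non-negative; the rule sees differences of carries.\<close>

definition level_carry :: "nat \<Rightarrow> (int \<Rightarrow> real) \<Rightarrow> real \<times> int \<Rightarrow> int" where
  "level_carry n x = (\<lambda>(z, m). int (den n (level_tag n x m)) * \<lfloor>x (m - 1) * (n * z)\<rfloor>
    - int (num n (level_tag n x m)) * int n * \<lfloor>x m * z\<rfloor> + int n + 1)"

locale scaling =
  fixes n :: nat and x :: "int \<Rightarrow> real"
  assumes n: "n \<ge> 2"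
    and x_bounds: "\<And>m. 1 \<le> x m \<and> x m \<le> real (n * (n + 1))"
    and x_step: "\<And>m. x m = real n * x (m + 1) \<or> real (n + 1) * x m = x (m + 1)"
begin

lemma tag_step: "real (den n (level_tag n x m)) * x (m - 1) = real (num n (level_tag n x m)) * x m"
  using x_step[of "m - 1"] by (auto simp: level_tag_def den_def num_def)

lemma level_digit_bounds: "1 \<le> level_digit x p \<and> level_digit x p \<le> int (n * (n + 1))"
proof -
  obtain z m where p: "p = (z, m)" by force
  have "\<lfloor>x m * z + of_int 1\<rfloor> \<le> \<lfloor>x m * (z + 1)\<rfloor>"
    using x_bounds[of m] by (intro floor_mono) (simp add: algebra_simps)
  moreover have "\<lfloor>x m * (z + 1)\<rfloor> \<le> \<lfloor>x m * z + of_int (int (n * (n + 1)))\<rfloor>"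
    using x_bounds[of m] by (intro floor_mono) (simp add: algebra_simps)
  ultimately show ?thesis by (simp only: floor_add_int[symmetric] level_digit_def p prod.case) linarith
qed

text \<open>By \<open>tag_step\<close> the scaled reals under the two floors coincide, so the scaled
  floors differ by rounding only: at most \<open>s \<le> n + 1\<close> one way and
  \<open>r * n \<le> n * n\<close> the other.\<close>

lemma level_carry_bounds: "0 \<le> level_carry n x p \<and> level_carry n x p \<le> int (n * n + n + 1)"
proof -
  obtain z m where p: "p = (z, m)" by force
  define s r where "s = den n (level_tag n x m)" and "r = num n (level_tag n x m)"
  define A B where "A = \<lfloor>x (m - 1) * (n * z)\<rfloor>" and "B = \<lfloor>x m * z\<rfloor>"
  have s: "s \<le> n + 1" and r: "r \<le> n" using n by (auto simp: s_def r_def den_def num_def)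
  have eq: "real s * (x (m - 1) * (n * z)) = real r * n * (x m * z)"
    using tag_step[of m] by (simp add: s_def r_def mult_ac)
  have A1: "real s * A \<le> real s * (x (m - 1) * (n * z))"
    unfolding A_def by (intro mult_left_mono) auto
  have A2: "real s * (x (m - 1) * (n * z)) \<le> real s * (A + 1)"
    unfolding A_def by (intro mult_left_mono) linarith+
  have B1: "real (r * n) * B \<le> real (r * n) * (x m * z)"
    unfolding B_def by (intro mult_left_mono) auto
  have B2: "real (r * n) * (x m * z) \<le> real (r * n) * (B + 1)"
    unfolding B_def by (intro mult_left_mono) linarith+
  have rn: "real (r * n) \<le> real (n * n)" using r by (simp only: of_nat_le_iff mult_le_mono1)
  have s': "real s \<le> real (n + 1)" using s by (simp only: of_nat_le_iff)
  have "real (r * n) * B \<le> real s * A + real (n + 1)"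
    using B1 A2 eq s' by (simp add: distrib_left mult.assoc)
  then have "real_of_int (int (r * n) * B) \<le> real_of_int (int s * A + int n + 1)"
    by (simp add: mult.assoc)
  then have low: "int (r * n) * B \<le> int s * A + int n + 1" by (simp only: of_int_le_iff)
  have "real s * A \<le> real (r * n) * B + real (n * n)"
    using A1 B2 eq rn by (simp add: distrib_left mult.assoc)
  then have "real_of_int (int s * A) \<le> real_of_int (int (r * n) * B + int (n * n))"
    by (simp add: mult.assoc)
  then have "int s * A \<le> int (r * n) * B + int (n * n)" by (simp only: of_int_le_iff)
  then show ?thesis using low
    by (simp add: level_carry_def p s_def r_def A_def B_def)
qed

text \<open>The block sum telescopes to floors at its ends, \<open>n * z\<close> and
  \<open>n * (z + 1)\<close>; the carries are chosen to absorb exactly these floors.\<close>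

lemma level_rule:
  fixes z :: real
  shows "int (den n (level_tag n x m)) * (\<Sum>i<n. level_digit x (n * z + real i, m - 1)) + level_carry n x (z, m)
    = int (num n (level_tag n x m)) * int n * level_digit x (z, m) + level_carry n x (z + 1, m)"
proof -
  have "(\<Sum>i<k. level_digit x (n * z + real i, m - 1))
      = \<lfloor>x (m - 1) * (n * z + real k)\<rfloor> - \<lfloor>x (m - 1) * (n * z)\<rfloor>" for k
    by (induction k) (simp_all add: level_digit_def algebra_simps)
  from this[of n] have "(\<Sum>i<n. level_digit x (n * z + real i, m - 1))
      = \<lfloor>x (m - 1) * (n * (z + 1))\<rfloor> - \<lfloor>x (m - 1) * (n * z)\<rfloor>"
    by (simp add: distrib_left)
  then show ?thesis
    by (simp only:) (simp add: level_carry_def level_digit_def right_diff_distrib)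
qed

definition level_letter :: "real \<times> int \<Rightarrow> nat" where
  "level_letter p = letter (level_tag n x (snd p)) (nat (level_digit x p)) (nat (level_carry n x p))"

lemma level_letter_in: "level_letter p \<in> letters 1 (n * (n + 1)) (n * n + n + 1)"
  unfolding level_letter_def using level_digit_bounds[of p] level_carry_bounds[of p]
  by (intro letter_in_letters) (simp_all add: level_tag_def nat_le_iff le_nat_iff del: of_nat_mult of_nat_add)

lemma level_letter_rule:
  fixes z :: real
  shows "den n (tag (level_letter (z, m))) * (\<Sum>i<n. digit (level_letter (n * z + real i, m - 1)))
      + carry (level_letter (z, m))
    = num n (tag (level_letter (z, m))) * n * digit (level_letter (z, m)) + carry (level_letter (z + 1, m))"
proof -
  \<comment> \<open>The bounds make \<open>nat\<close> lossless, so the integer identity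
    transfers.\<close>
  have d: "int (nat (level_digit x p)) = level_digit x p" for p
    using level_digit_bounds[of p] by simp
  have c: "int (nat (level_carry n x p)) = level_carry n x p" for p
    using level_carry_bounds[of p] by simp
  have "int (den n (level_tag n x m) * (\<Sum>i<n. nat (level_digit x (n * z + real i, m - 1)))
      + nat (level_carry n x (z, m)))
    = int (num n (level_tag n x m) * n * nat (level_digit x (z, m)) + nat (level_carry n x (z + 1, m)))"
    using level_rule[of m z] by (simp only: of_nat_add of_nat_mult of_nat_sum d c)
  then show ?thesis by (simp only: of_nat_eq_iff) (simp add: level_letter_def)
qed

end

section \<open>Words acting on positions\<close>

text \<open>Words act from the right on pairs \<open>(z, m)\<close>; the group element \<open>t \<mapsto> n\<^sup>m (t + z)\<close> corresponds to
  \<open>(z, m)\<close>, so that \<open>m\<close> is its level and \<open>z\<close> its position measured in steps \<open>a\<close>.\<close>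

fun letter_step :: "nat \<Rightarrow> bs_gen \<times> bool \<Rightarrow> real \<times> int \<Rightarrow> real \<times> int" where
  "letter_step n (gen_a, s) (z, m) = (if s then z + 1 else z - 1, m)"
| "letter_step n (gen_b, s) (z, m) = (if s then (z / real n, m + 1) else (real n * z, m - 1))"

abbreviation BS_rels :: "nat \<Rightarrow> (bs_gen word \<times> bs_gen word) set" where
  "BS_rels n \<equiv> {([(gen_b, True), (gen_a, True), (gen_b, False)], replicate n (gen_a, True))}"

lemma letter_step_a_pow: "(letter_step n (gen_a, True) ^^ k) (z, m) = (z + real k, m)"
  by (induction k) simp_all

text \<open>The action respects the relation: \<open>b\<close>, \<open>a\<close>, then the inverse
  of \<open>b\<close> send \<open>z\<close> to \<open>z / n\<close>, \<open>z / n + 1\<close> and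
  \<open>z + n\<close>, as do \<open>n\<close> letters \<open>a\<close>.\<close>

lemma pres_eq_letter_step:
  assumes n: "n \<ge> 2" and "pres_eq (BS_rels n) u v"
  shows "fold (letter_step n) u = fold (letter_step n) v"
  using assms(2)
proof (induction rule: pres_eq.induct)
  case (pres_cancel u g s v)
  have "fold (letter_step n) [(g, s), (g, \<not> s)] p = p" for p
    using n by (cases p; cases g) auto
  then show ?case by (auto simp: fun_eq_iff)
next
  case (pres_rel l r u v)
  have "fold (letter_step n) l p = fold (letter_step n) r p" for p
  proof -
    obtain z m where p: "p = (z, m)" by force
    show ?thesis using pres_rel n unfolding p
      by (auto simp: letter_step_a_pow algebra_simps)
  qed
  then show ?case by (auto simp: fun_eq_iff)
qed auto

text \<open>The orbit map of \<open>(0, 0)\<close>; the choice of word is immaterial by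
  \<open>BS_point_class\<close>.\<close>

definition BS_point :: "nat \<Rightarrow> bs_gen word set \<Rightarrow> real \<times> int" where
  "BS_point n h = fold (letter_step n) (SOME u. h = pres_class (BS_rels n) u) (0, 0)"

lemma BS_point_class:
  assumes "n \<ge> 2"
  shows "BS_point n (pres_class (BS_rels n) u) = fold (letter_step n) u (0, 0)"
proof -
  define v where "v = (SOME v. pres_class (BS_rels n) u = pres_class (BS_rels n) v)"
  have "pres_class (BS_rels n) u = pres_class (BS_rels n) v"
    unfolding v_def by (rule someI[of _ u]) simp
  then have "fold (letter_step n) u = fold (letter_step n) v"
    using pres_eq_letter_step[OF assms] by (simp only: pres_class_eq_iff)
  then show ?thesis by (simp only: BS_point_def flip: v_def)
qed

section \<open>Strong aperiodicity\<close>

abbreviation BS_a :: "nat \<Rightarrow> bs_gen word set" where "BS_a n \<equiv> pres_class (BS_rels n) [(gen_a, True)]"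
abbreviation BS_b :: "nat \<Rightarrow> bs_gen word set" where "BS_b n \<equiv> pres_class (BS_rels n) [(gen_b, True)]"

lemma BS1_mult: "pres_class (BS_rels n) u \<otimes>\<^bsub>BS1 n\<^esub> pres_class (BS_rels n) v = pres_class (BS_rels n) (u @ v)"
  unfolding BS1_def by (rule pres_class_mult)

lemma BS1_carrier: "carrier (BS1 n) = range (pres_class (BS_rels n))"
  by (simp add: BS1_def presented_group_def)

lemma BS1_one: "\<one>\<^bsub>BS1 n\<^esub> = pres_class (BS_rels n) []"
  by (simp add: BS1_def presented_group_def)

lemma BS1_inv_generator: "inv\<^bsub>BS1 n\<^esub> pres_class (BS_rels n) [(g, True)] = pres_class (BS_rels n) [(g, False)]"
proof (rule group.inv_equality[OF group_BS1])
  show "pres_class (BS_rels n) [(g, False)] \<otimes>\<^bsub>BS1 n\<^esub> pres_class (BS_rels n) [(g, True)] = \<one>\<^bsub>BS1 n\<^esub>"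
    using pres_cancel[of "BS_rels n" "[]" g False "[]"]
    by (simp add: BS1_mult BS1_one pres_class_eq_iff)
qed (simp_all add: BS1_carrier)

lemma BS1_a_pow: "BS_a n [^]\<^bsub>BS1 n\<^esub> (k::nat) = pres_class (BS_rels n) (replicate k (gen_a, True))"
  by (induction k) (simp_all add: BS1_one BS1_mult group.is_monoid[OF group_BS1] replicate_append_same)

lemma bs_group_BS1: "bs_group (BS1 n) (BS_a n) (BS_b n) n"
proof -
  interpret group "BS1 n" by (rule group_BS1)
  show ?thesis
  proof
    \<comment> \<open>Append \<open>b\<close> to both sides of the defining relation and
      cancel.\<close>
    have "pres_eq (BS_rels n) ([] @ [(gen_b, True), (gen_a, True), (gen_b, False)] @ [(gen_b, True)])
        ([] @ replicate n (gen_a, True) @ [(gen_b, True)])"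
      by (rule pres_rel) simp
    moreover have "pres_eq (BS_rels n) ([(gen_b, True), (gen_a, True)] @ [(gen_b, False), (gen_b, \<not> False)] @ [])
        ([(gen_b, True), (gen_a, True)] @ [])"
      by (rule pres_cancel)
    ultimately have "pres_eq (BS_rels n) [(gen_b, True), (gen_a, True)]
        (replicate n (gen_a, True) @ [(gen_b, True)])"
      unfolding append_Nil append_Cons append_Nil2 not_False_eq_True
      by (rule pres_trans[OF pres_sym, rotated])
    then show "BS_b n \<otimes>\<^bsub>BS1 n\<^esub> BS_a n = BS_a n [^]\<^bsub>BS1 n\<^esub> n \<otimes>\<^bsub>BS1 n\<^esub> BS_b n"
      by (simp add: BS1_a_pow BS1_mult pres_class_eq_iff)
  qed (simp_all add: BS1_carrier)
qed

text \<open>Normal forms contain the identity and are closed under right multiplication by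
  generators and their inverses, so words are absorbed letter by letter.\<close>

lemma BS1_normal_forms: "carrier (BS1 n) \<subseteq> bs_group.normal_forms (BS1 n) (BS_a n) (BS_b n)"
proof -
  interpret bs_group "BS1 n" "BS_a n" "BS_b n" n by (rule bs_group_BS1)
  have "pres_class (BS_rels n) u \<in> normal_forms" for u
  proof (induction u rule: rev_induct)
    case Nil
    then show ?case using one_normal_form by (simp add: BS1_one)
  next
    case (snoc y u)
    obtain g s where y: "y = (g, s)" by force
    have y_mult: "pres_class (BS_rels n) (u @ [y])
        = pres_class (BS_rels n) u \<otimes>\<^bsub>BS1 n\<^esub> pres_class (BS_rels n) [y]"
      by (simp add: BS1_mult)
    have "pres_class (BS_rels n) [y] = (if s then pres_class (BS_rels n) [(g, True)]
        else inv\<^bsub>BS1 n\<^esub> pres_class (BS_rels n) [(g, True)])"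
      by (simp add: y BS1_inv_generator)
    then show ?case unfolding y_mult
      using normal_forms_mult[OF snoc] normal_forms_mult(1)[OF snoc, of 1] normal_forms_mult(1)[OF snoc, of "- 1"]
      by (cases g) (auto simp: int_pow_neg int_pow_1)
  qed
  then show ?thesis by (auto simp: BS1_carrier)
qed

lemma BS1_kari_nonempty:
  assumes n: "n \<ge> 2"
  shows "bs_group.kari (BS1 n) (BS_a n) (BS_b n) n \<noteq> {}"
proof -
  interpret bs_group "BS1 n" "BS_a n" "BS_b n" n by (rule bs_group_BS1)
  obtain x where "scaling n x" using scaling_orbit[OF n] n unfolding scaling_def by metis
  then interpret scaling n x .
  \<comment> \<open>From \<open>(z, m)\<close>, \<open>a\<close> leads to \<open>(z + 1, m)\<close>
    and \<open>inv b\<close> followed by \<open>a [^] i\<close> to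
    \<open>(n * z + i, m - 1)\<close>: the arguments of \<open>level_letter_rule\<close>.\<close>
  define c where "c = (\<lambda>h\<in>carrier (BS1 n). level_letter (BS_point n h))"
  have "c \<in> configurations (BS1 n) alphabet"
    using level_letter_in by (auto simp: c_def configurations_def alphabet_def)
  moreover have "local_rule (\<lambda>h\<in>window. c (g \<otimes>\<^bsub>BS1 n\<^esub> h))" if g: "g \<in> carrier (BS1 n)" for g
  proof -
    obtain u where u: "g = pres_class (BS_rels n) u" using g by (auto simp: BS1_carrier)
    obtain z m where zm: "fold (letter_step n) u (0, 0) = (z, m)" by force
    have c_class: "c (pres_class (BS_rels n) w) = level_letter (fold (letter_step n) w (0, 0))" for w
      by (simp add: c_def BS1_carrier BS_point_class[OF n])
    have "c g = level_letter (z, m)" by (simp add: u c_class zm)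
    moreover have "c (g \<otimes>\<^bsub>BS1 n\<^esub> BS_a n) = level_letter (z + 1, m)"
      by (simp add: u BS1_mult c_class zm)
    moreover have "c (g \<otimes>\<^bsub>BS1 n\<^esub> (inv\<^bsub>BS1 n\<^esub> BS_b n \<otimes>\<^bsub>BS1 n\<^esub> BS_a n [^]\<^bsub>BS1 n\<^esub> i))
        = level_letter (real n * z + real i, m - 1)" for i :: nat
      by (simp add: u BS1_inv_generator BS1_a_pow BS1_mult c_class zm letter_step_a_pow)
    ultimately show ?thesis
      using level_letter_rule[of z m] g by (simp add: local_rule_window level_letter_def)
  qed
  ultimately have "c \<in> kari" by (simp add: kari_def)
  then show ?thesis by blast
qed

theorem theorem2p20:
  fixes n :: nat
  assumes "n \<ge> 2"
  shows "\<exists>(A :: nat set) X. finite A \<and> is_SFT (BS1 n) A X \<and> strongly_aperiodic (BS1 n) A X"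
proof -
  interpret bs_group "BS1 n" "BS_a n" "BS_b n" n by (rule bs_group_BS1)
  have "finite alphabet" by (simp add: alphabet_def finite_letters)
  moreover have "strongly_aperiodic (BS1 n) alphabet kari"
    unfolding strongly_aperiodic_def
    using kari_not_weakly_periodic[OF assms BS1_normal_forms] BS1_kari_nonempty[OF assms] by blast
  ultimately show ?thesis using is_SFT_kari by blast
qed

end
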